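(* Let $m\in\mathbb{N}$, $m\geq 1$, and let $0^m1$ denote the word starting with $m$ zeros and ending with a single one. Let $v$ be a finite word with letters in $\{0,1,\ast\}$ such that $1\le|v|_\ast\le|v|\le m$. Let $p$ be the length of the word $0^m1v$, $q$ the number of letters $\ast$ in it, and $d=\gcd(p,q)$. Then $\omega:=T(0^m1v)$ is a $(p,q)$-Toeplitz word, and the corresponding regular Toeplitz subshift $(\Sigma_\omega,\sigma)$ has amorphic complexity $$\mathrm{ac}(\sigma|_{\Sigma_\omega})=\frac{\log(p/d)}{\log(p/q)}.$$
   Context: Amorphic complexity. Let $(X,d)$ be a metric space and $f:X\to X$. For $x,y\in X$, $\delta>0$, $n\in\mathbb{N}$ let $S_n(f,\delta,x,y)=\#\{0\le k<n \mid d(f^k(x),f^k(y))\ge\delta\}$. For $\nu\in(0,1]$, points $x,y$ are $(f,\delta,\nu)$-separated if $\limsup_{n\to\infty} S_n(f,\delta,x,y)/n\ge\nu$. A subset is $(f,\delta,\nu)$-separated if all pairs of distinct points of it are. $\operatorname{Sep}(f,\delta,\nu)$ is the largest cardinality (possibly $\infty$) of an $(f,\delta,\nu)$-separated subset of $X$. Set $\underline{\mathrm{ac}}(f)=\sup_{\delta>0}\liminf_{\nu\to0}\frac{\log\operatorname{Sep}(f,\delta,\nu)}{-\log\nu}$ and $\overline{\mathrm{ac}}(f)=\sup_{\delta>0}\limsup_{\nu\to0}\frac{\log\operatorname{Sep}(f,\delta,\nu)}{-\log\nu}$; if they coincide, the common value is $\mathrm{ac}(f)$. Sequences. Let $A=\{0,1\}$,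 $\mathcal{A}=A\cup\{\ast\}$ ($\ast$ is called a hole); sequences are indexed by $\mathbb{N}_0$. $\Sigma_A=A^{\mathbb{N}_0}$ (and $\Sigma_{\mathcal{A}}=\mathcal{A}^{\mathbb{N}_0}$) carries the metric $\rho(x,y)=2^{-j}$, $j=\min\{k : x_k\ne y_k\}$ for $x\neq y$; $\sigma$ is the left shift; $\Sigma_\omega$ is the shift orbit closure of $\omega$. For a word $w$, $|w|$ is its length and $|w|_\ast$ the number of holes in it. $(p,q)$-Toeplitz words. Let $w$ be a finite word over $\mathcal{A}$ whose first letter is not $\ast$. Let $\overline{w}\in\Sigma_{\mathcal{A}}$ be the periodic sequence $www\cdots$. Let $F_w:\Sigma_{\mathcal{A}}\to\Sigma_{\mathcal{A}}$ assign to $x$ the sequence obtained from $\overline{w}$ by replacing the subsequence of all occurrences of $\ast$ in $\overline{w}$ by $x$ (the $i$-th hole is replaced by the $i$-th letter of $x$). Put $T_0(w)=\overline{\ast}$ and $T_\ell(w)=F_w(T_{\ell-1}(w))$. Then $T(w)=\lim_{\ell\to\infty}T_\ell(w)\in\Sigma_A$ (the entry at each position is eventually a constant letter of $A$). With $p=|w|$ and $q=|w|_\ast$, $T(w)$ is called a $(p,q)$-Toeplitz word. Regular Toeplitz. A sequence $\omega\in\Sigma_A$ is Toeplitz if for all $k\in\mathbb{N}_0$ there is $p\in\mathbb{N}$ with $\omega_{k+p\ell}=\omega_k$ for all $\ell\in\mathbb{N}$. With $\operatorname{Per}(p,\omega)=\{k\mid \omega_{k+p\ell}=\omega_k\ \forall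 \ell\in\mathbb{N}\}$ and $D(p)=\#(\operatorname{Per}(p,\omega)\cap[0,p-1])/p$, it is regular if $\lim_{\ell\to\infty}D(p_\ell)=1$ for some (equivalently every) sequence $(p_\ell)$ of positive integers with $p_\ell\mid p_{\ell+1}$ and $\bigcup_\ell\operatorname{Per}(p_\ell,\omega)=\mathbb{N}_0$. *)

theory Defs
  imports "HOL-Analysis.Analysis" "HOL-Library.Z2"
begin

section \<open>Amorphic complexity\<close>

text \<open>A metric space is given by a carrier \<open>X\<close> and a distance function \<open>d\<close>, as in the locale
  \<^locale>\<open>Metric_space\<close>; only the values of \<open>f\<close> on \<open>X\<close> matter when \<open>f\<close> maps \<open>X\<close> to itself.\<close>

definition sep_count ::
    "('a \<Rightarrow> 'a \<Rightarrow> real) \<Rightarrow> ('a \<Rightarrow> 'a) \<Rightarrow> real \<Rightarrow> 'a \<Rightarrow> 'a \<Rightarrow> nat \<Rightarrow> nat" where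
  "sep_count d f \<delta> x y n = card {k. k < n \<and> d ((f ^^ k) x) ((f ^^ k) y) \<ge> \<delta>}"

definition separated_points ::
    "('a \<Rightarrow> 'a \<Rightarrow> real) \<Rightarrow> ('a \<Rightarrow> 'a) \<Rightarrow> real \<Rightarrow> real \<Rightarrow> 'a \<Rightarrow> 'a \<Rightarrow> bool" where
  "separated_points d f \<delta> \<nu> x y \<longleftrightarrow>
     limsup (\<lambda>n. ereal (real (sep_count d f \<delta> x y n) / real n)) \<ge> ereal \<nu>"

definition separated_set ::
    "('a \<Rightarrow> 'a \<Rightarrow> real) \<Rightarrow> ('a \<Rightarrow> 'a) \<Rightarrow> real \<Rightarrow> real \<Rightarrow> 'a set \<Rightarrow> bool" where
  "separated_set d f \<delta> \<nu> S \<longleftrightarrow> (\<forall>x\<in>S. \<forall>y\<in>S. x \<noteq> y \<longrightarrow> separated_points d f \<delta> \<nu> x y)"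

definition Sep :: "'a set \<Rightarrow> ('a \<Rightarrow> 'a \<Rightarrow> real) \<Rightarrow> ('a \<Rightarrow> 'a) \<Rightarrow> real \<Rightarrow> real \<Rightarrow> enat" where
  "Sep X d f \<delta> \<nu> =
     (SUP S \<in> {S. S \<subseteq> X \<and> separated_set d f \<delta> \<nu> S}. if finite S then enat (card S) else \<infinity>)"

definition ln_enat :: "enat \<Rightarrow> ereal" where
  "ln_enat n = (case n of enat k \<Rightarrow> if k = 0 then -\<infinity> else ereal (ln (real k)) | \<infinity> \<Rightarrow> \<infinity>)"

definition lower_ac :: "'a set \<Rightarrow> ('a \<Rightarrow> 'a \<Rightarrow> real) \<Rightarrow> ('a \<Rightarrow> 'a) \<Rightarrow> ereal" where
  "lower_ac X d f =
     (SUP \<delta>\<in>{0<..}. Liminf (at_right 0) (\<lambda>\<nu>. ln_enat (Sep X d f \<delta> \<nu>) / ereal (- ln \<nu>)))"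

definition upper_ac :: "'a set \<Rightarrow> ('a \<Rightarrow> 'a \<Rightarrow> real) \<Rightarrow> ('a \<Rightarrow> 'a) \<Rightarrow> ereal" where
  "upper_ac X d f =
     (SUP \<delta>\<in>{0<..}. Limsup (at_right 0) (\<lambda>\<nu>. ln_enat (Sep X d f \<delta> \<nu>) / ereal (- ln \<nu>)))"

text \<open>The amorphic complexity exists and equals \<open>c\<close>.\<close>

definition has_amorphic_complexity ::
    "'a set \<Rightarrow> ('a \<Rightarrow> 'a \<Rightarrow> real) \<Rightarrow> ('a \<Rightarrow> 'a) \<Rightarrow> ereal \<Rightarrow> bool" where
  "has_amorphic_complexity X d f c \<longleftrightarrow> lower_ac X d f = c \<and> upper_ac X d f = c"


section \<open>Sequences and subshifts\<close>

text \<open>Sequences over an alphabet \<open>'b\<close> are functions \<^typ>\<open>nat \<Rightarrow> 'b\<close>.  The alphabet $\{0,1\}$ is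
  \<^typ>\<open>bit\<close>, and $\{0,1,*\}$ is \<^typ>\<open>bit option\<close> with the hole $*$ rendered as \<^term>\<open>None\<close>.\<close>

definition cantor_dist :: "(nat \<Rightarrow> 'b) \<Rightarrow> (nat \<Rightarrow> 'b) \<Rightarrow> real" where
  "cantor_dist x y = (if x = y then 0 else (1/2) ^ (LEAST k. x k \<noteq> y k))"

lemma cantor_dist_less_iff: "cantor_dist x y < (1/2) ^ n \<longleftrightarrow> (\<forall>k\<le>n. x k = y k)"
proof (cases "x = y")
  case False
  then obtain j where "x j \<noteq> y j" by blast
  then have L: "x (LEAST k. x k \<noteq> y k) \<noteq> y (LEAST k. x k \<noteq> y k)"
    by (rule LeastI)
  have "n < (LEAST k. x k \<noteq> y k) \<longleftrightarrow> (\<forall>k\<le>n. x k = y k)"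
    using L not_less_Least[of _ "\<lambda>k. x k \<noteq> y k"]
    by (meson le_less_trans not_le_imp_less)
  then show ?thesis
    using False by (simp add: cantor_dist_def power_strict_decreasing_iff)
qed (simp add: cantor_dist_def)

lemma Metric_space_cantor_dist: "Metric_space UNIV cantor_dist"
proof
  fix x y z :: "nat \<Rightarrow> 'b"
  show "0 \<le> cantor_dist x y"
    by (simp add: cantor_dist_def)
  have "(LEAST k. x k \<noteq> y k) = (LEAST k. y k \<noteq> x k)"
    by metis
  then show "cantor_dist x y = cantor_dist y x"
    by (auto simp: cantor_dist_def)
  show "cantor_dist x y = 0 \<longleftrightarrow> x = y"
    by (simp add: cantor_dist_def)
  show "cantor_dist x z \<le> cantor_dist x y + cantor_dist y z"
  proof (cases "x = z")
    case False
    define n where "n = (LEAST k. x k \<noteq> z k)"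
    have n: "cantor_dist x z = (1/2) ^ n"
      using False by (simp add: cantor_dist_def n_def)
    then have "\<exists>k\<le>n. x k \<noteq> z k"
      using cantor_dist_less_iff[of x z n] by simp
    then obtain k where "k \<le> n" "x k \<noteq> z k"
      by blast
    then have "\<not> (cantor_dist x y < (1/2) ^ n \<and> cantor_dist y z < (1/2) ^ n)"
      unfolding cantor_dist_less_iff by force
    moreover have "0 \<le> cantor_dist x y" "0 \<le> cantor_dist y z"
      by (simp_all add: cantor_dist_def)
    ultimately show ?thesis
      using n by linarith
  qed (simp add: cantor_dist_def)
qed

abbreviation cantor_topology :: "(nat \<Rightarrow> 'b) topology" where
  "cantor_topology \<equiv> Metric_space.mtopology UNIV cantor_dist"

definition shift :: "(nat \<Rightarrow> 'b) \<Rightarrow> (nat \<Rightarrow> 'b)" where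
  "shift x = (\<lambda>n. x (Suc n))"

definition shift_orbit_closure :: "(nat \<Rightarrow> 'b) \<Rightarrow> (nat \<Rightarrow> 'b) set" where
  "shift_orbit_closure \<omega> = cantor_topology closure_of {(shift ^^ n) \<omega> | n. True}"


section \<open>Regular Toeplitz sequences\<close>

definition toeplitz :: "(nat \<Rightarrow> 'b) \<Rightarrow> bool" where
  "toeplitz \<omega> \<longleftrightarrow> (\<forall>k. \<exists>p>0. \<forall>l. \<omega> (k + p * l) = \<omega> k)"

definition Per :: "nat \<Rightarrow> (nat \<Rightarrow> 'b) \<Rightarrow> nat set" where
  "Per p \<omega> = {k. \<forall>l. \<omega> (k + p * l) = \<omega> k}"

definition per_density :: "(nat \<Rightarrow> 'b) \<Rightarrow> nat \<Rightarrow> real" where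
  "per_density \<omega> p = real (card (Per p \<omega> \<inter> {0..<p})) / real p"

definition regular_toeplitz :: "(nat \<Rightarrow> 'b) \<Rightarrow> bool" where
  "regular_toeplitz \<omega> \<longleftrightarrow> toeplitz \<omega> \<and>
     (\<exists>P :: nat \<Rightarrow> nat. (\<forall>l. P l > 0) \<and> (\<forall>l. P l dvd P (Suc l)) \<and> (\<Union>l. Per (P l) \<omega>) = UNIV \<and>
        (\<lambda>l. per_density \<omega> (P l)) \<longlonglongrightarrow> 1)"


section \<open>\<open>(p,q)\<close>-Toeplitz words\<close>

definition holes :: "'b option list \<Rightarrow> nat" where
  "holes w = count_list w None"

definition periodic_seq :: "'a list \<Rightarrow> nat \<Rightarrow> 'a" where
  "periodic_seq w n = w ! (n mod length w)"

text \<open>A hole of \<open>periodic_seq w\<close> at position \<open>n\<close> receives the letter of \<open>x\<close> whose index is the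
  number of earlier holes, since both holes and letters are counted from 0.\<close>

definition fill_holes :: "'b option list \<Rightarrow> (nat \<Rightarrow> 'b option) \<Rightarrow> nat \<Rightarrow> 'b option" where
  "fill_holes w x n =
     (if periodic_seq w n = None then x (card {k. k < n \<and> periodic_seq w k = None})
      else periodic_seq w n)"

definition toeplitz_approx :: "'b option list \<Rightarrow> nat \<Rightarrow> nat \<Rightarrow> 'b option" where
  "toeplitz_approx w l = (fill_holes w ^^ l) (\<lambda>_. None)"

definition toeplitz_word :: "'b option list \<Rightarrow> nat \<Rightarrow> 'b" where
  "toeplitz_word w =
     (THE x. limitin cantor_topology (toeplitz_approx w) (\<lambda>n. Some (x n)) sequentially)"

lemma toeplitz_approx_stable:
  assumes "w \<noteq> []" "hd w \<noteq> None" "n < l"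
  shows "toeplitz_approx w l n = toeplitz_approx w (Suc n) n" "toeplitz_approx w l n \<noteq> None"
proof -
  have *: "toeplitz_approx w l n = toeplitz_approx w (Suc n) n \<and> toeplitz_approx w l n \<noteq> None"
    if "n < l" for n l
    using that
  proof (induction n arbitrary: l rule: less_induct)
    case (less n)
    then obtain l' where l': "l = Suc l'" "n \<le> l'"
      by (cases l) auto
    have step: "toeplitz_approx w (Suc j) n = fill_holes w (toeplitz_approx w j) n" for j
      by (simp add: toeplitz_approx_def)
    show ?case
    proof (cases "periodic_seq w n = None")
      case False
      then have "fill_holes w x n = periodic_seq w n" for x
        unfolding fill_holes_def by (rule if_not_P)
      then show ?thesis
        using False unfolding l'(1) step by simp
    next
      case True
      let ?c = "card {k. k < n \<and> periodic_seq w k = None}"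
      have 0: "periodic_seq w 0 \<noteq> None"
        using assms by (simp add: periodic_seq_def hd_conv_nth)
      with True have "n > 0"
        using gr0I by force
      have "{k. k < n \<and> periodic_seq w k = None} \<subseteq> {1..<n}"
      proof
        fix k assume "k \<in> {k. k < n \<and> periodic_seq w k = None}"
        then show "k \<in> {1..<n}"
          using 0 by (cases k) simp_all
      qed
      then have "?c \<le> card {1..<n}"
        by (intro card_mono finite_atLeastLessThan)
      then have "?c < n"
        unfolding card_atLeastLessThan using \<open>n > 0\<close> by linarith
      have "?c < l'"
        using \<open>?c < n\<close> l'(2) by (rule order_less_le_trans)
      note IH = less.IH[OF \<open>?c < n\<close> \<open>?c < l'\<close>] less.IH[OF \<open>?c < n\<close> \<open>?c < n\<close>]
      have "fill_holes w x n = x ?c" for x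
        unfolding fill_holes_def using True by (rule if_P)
      then have "toeplitz_approx w l n = toeplitz_approx w l' ?c"
        "toeplitz_approx w (Suc n) n = toeplitz_approx w n ?c"
        by (simp_all only: l'(1) step)
      then show ?thesis
        using IH by argo
    qed
  qed
  show "toeplitz_approx w l n = toeplitz_approx w (Suc n) n" "toeplitz_approx w l n \<noteq> None"
    using *[OF assms(3)] by blast+
qed

text \<open>The defining limit exists and is unique whenever the first letter is not a hole.\<close>

lemma limitin_toeplitz_word:
  assumes "w \<noteq> []" "hd w \<noteq> None"
  shows "limitin cantor_topology (toeplitz_approx w) (\<lambda>n. Some (toeplitz_word w n)) sequentially"
proof -
  interpret Metric_space UNIV "cantor_dist :: (nat \<Rightarrow> 'a option) \<Rightarrow> _"
    by (rule Metric_space_cantor_dist)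
  let ?y = "\<lambda>n. the (toeplitz_approx w (Suc n) n)"
  have "\<exists>N. \<forall>l\<ge>N. cantor_dist (toeplitz_approx w l) (\<lambda>n. Some (?y n)) < \<epsilon>" if "\<epsilon> > 0" for \<epsilon>
  proof -
    obtain K where K: "(1/2 :: real) ^ K < \<epsilon>"
      using real_arch_pow_inv[OF \<open>\<epsilon> > 0\<close>, of "1/2"] by auto
    have "cantor_dist (toeplitz_approx w l) (\<lambda>n. Some (?y n)) < (1/2) ^ K" if "l \<ge> Suc K" for l
      unfolding cantor_dist_less_iff
    proof (intro allI impI)
      fix k assume "k \<le> K"
      then have "k < l"
        using that by simp
      then show "toeplitz_approx w l k = Some (?y k)"
        using toeplitz_approx_stable[OF assms, of k l] by (metis option.collapse)
    qed
    then show ?thesis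
      using K by (meson less_trans)
  qed
  then have lim: "limitin cantor_topology (toeplitz_approx w) (\<lambda>n. Some (?y n)) sequentially"
    by (simp add: limit_metric_sequentially)
  show ?thesis
    unfolding toeplitz_word_def
  proof (rule theI[where a = ?y])
    fix x :: "nat \<Rightarrow> 'a"
    assume "limitin cantor_topology (toeplitz_approx w) (\<lambda>n. Some (x n)) sequentially"
    then have "(\<lambda>n. Some (x n)) = (\<lambda>n. Some (?y n))"
      by (rule limitin_metric_unique[OF _ lim trivial_limit_sequentially])
    then show "x = ?y"
      by (auto simp: fun_eq_iff)
  qed (rule lim)
qed

definition pq_toeplitz_word :: "nat \<Rightarrow> nat \<Rightarrow> (nat \<Rightarrow> 'b) \<Rightarrow> bool" where
  "pq_toeplitz_word p q \<omega> \<longleftrightarrow>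
     (\<exists>w. w \<noteq> [] \<and> hd w \<noteq> None \<and> length w = p \<and> holes w = q \<and> \<omega> = toeplitz_word w)"

end

theory Submission
  imports Defs
begin

text \<open>Write \<open>\<theta> = q / p\<close>, \<open>p' = p / d\<close>, \<open>q' = q / d\<close>.  The \<open>l\<close>-th approximation of the Toeplitz word has
  period \<open>d p'\<^sup>l\<close> and hole density \<open>\<theta>\<^sup>l\<close>.  Each point of the subshift agrees, outside the holes, with a
  translate of this approximation, and there are only \<open>d p'\<^sup>l\<close> translates; two points sharing the
  translate are not separated once \<open>\<nu>\<close> exceeds a constant multiple of \<open>\<theta>\<^sup>l\<close>.

  Conversely, let \<open>\<Delta>(j)\<close> be the density of the places where the word differs from its translate by \<open>j\<close>.
  The shape of \<open>0\<^sup>m1v\<close> forces \<open>\<Delta>(j) \<ge> 1 / p\<close> unless \<open>p\<close> divides \<open>j\<close>, and self-similarity gives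
  \<open>\<Delta>(p i) = \<theta> \<Delta>(q i)\<close>.  If \<open>d p'\<^sup>l\<^sup>+\<^sup>1\<close> does not divide \<open>j\<close>, this recursion stops within \<open>l\<close> steps, so
  \<open>\<Delta>(j) \<ge> \<theta>\<^sup>l / p\<close>, and the first \<open>d p'\<^sup>l\<^sup>+\<^sup>1\<close> points of the orbit are separated.  Comparing growth rates
  gives \<open>ln p' / ln (1 / \<theta>)\<close>.\<close>

section \<open>Amorphic complexity from geometric estimates\<close>

text \<open>A bounded error vanishes after division by \<open>n\<close>, so the counting bounds
  below may carry arbitrary additive constants.\<close>

lemma limsup_ge_of_linear_lower_bound:
  fixes f :: "nat \<Rightarrow> nat"
  assumes "\<And>n. c * real n - C \<le> real (f n)"
  shows "ereal c \<le> limsup (\<lambda>n. ereal (real (f n) / real n))"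
proof -
  have "(\<lambda>n. c - C / real n) \<longlonglongrightarrow> c - 0"
    by (intro tendsto_diff tendsto_const lim_const_over_n)
  then have "limsup (\<lambda>n. ereal (c - C / real n)) = ereal c"
    by (intro lim_imp_Limsup) auto
  moreover have "limsup (\<lambda>n. ereal (c - C / real n)) \<le> limsup (\<lambda>n. ereal (real (f n) / real n))"
  proof (intro Limsup_mono eventually_mono[OF eventually_gt_at_top[of 0]])
    fix n :: nat assume "n > 0"
    then show "ereal (c - C / real n) \<le> ereal (real (f n) / real n)"
      using divide_right_mono[OF assms[of n], of "real n"] by (simp add: diff_divide_distrib)
  qed
  ultimately show ?thesis by simp
qed

lemma limsup_le_of_linear_upper_bound:
  fixes f :: "nat \<Rightarrow> nat"
  assumes "\<And>n. real (f n) \<le> c * real n + C"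
  shows "limsup (\<lambda>n. ereal (real (f n) / real n)) \<le> ereal c"
proof -
  have "(\<lambda>n. c + C / real n) \<longlonglongrightarrow> c + 0"
    by (intro tendsto_add tendsto_const lim_const_over_n)
  then have "limsup (\<lambda>n. ereal (c + C / real n)) = ereal c"
    by (intro lim_imp_Limsup) auto
  moreover have "limsup (\<lambda>n. ereal (real (f n) / real n)) \<le> limsup (\<lambda>n. ereal (c + C / real n))"
  proof (intro Limsup_mono eventually_mono[OF eventually_gt_at_top[of 0]])
    fix n :: nat assume "n > 0"
    then show "ereal (real (f n) / real n) \<le> ereal (c + C / real n)"
      using divide_right_mono[OF assms[of n], of "real n"] by (simp add: add_divide_distrib)
  qed
  ultimately show ?thesis by simp
qed

lemma ln_enat_mono: "a \<le> b \<Longrightarrow> ln_enat a \<le> ln_enat b"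
  by (cases a; cases b) (auto simp: ln_enat_def)

lemma lower_ac_le_upper_ac: "lower_ac X d f \<le> upper_ac X d f"
  unfolding lower_ac_def upper_ac_def
  by (intro SUP_mono') (simp add: Liminf_le_Limsup)

lemma filterlim_minus_ln_at_right_0: "filterlim (\<lambda>x::real. - ln x) at_top (at_right 0)"
  using ln_at_0 by (simp add: filterlim_uminus_at_bot)

lemma eventually_at_right_0_less_1: "\<forall>\<^sub>F x in at_right 0. 0 < x \<and> x < (1::real)"
  by (simp add: eventually_at_right_field) (use zero_less_one in blast)

lemma tendsto_affine_minus_ln_quotient:
  "((\<lambda>\<nu>::real. ereal ((A + c * (- ln \<nu>)) / (- ln \<nu>))) \<longlongrightarrow> ereal c) (at_right 0)"
proof -
  have "((\<lambda>\<nu>::real. A / (- ln \<nu>) + c) \<longlongrightarrow> 0 + c) (at_right 0)"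
    by (intro tendsto_add tendsto_const tendsto_divide_0[OF tendsto_const]
        filterlim_at_top_imp_at_infinity filterlim_minus_ln_at_right_0)
  moreover have "\<forall>\<^sub>F \<nu>::real in at_right 0. A / (- ln \<nu>) + c = (A + c * (- ln \<nu>)) / (- ln \<nu>)"
    using eventually_at_right_0_less_1
    by eventually_elim (auto simp: field_simps)
  ultimately show ?thesis
    by (auto intro: Lim_transform_eventually)
qed

text \<open>At the scale \<open>\<theta> ^ l\<close>, up to constants, \<open>Sep\<close> grows like
  \<open>b ^ l\<close>; rounding \<open>\<nu>\<close> to such a scale costs a bounded factor, lost
  in the limit. One \<open>\<delta>\<close> suffices for the lower estimate because both
  complexities are suprema over \<open>\<delta>\<close>.\<close>

lemma has_amorphic_complexity_geometric:
  fixes b \<theta> C :: real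
  assumes b: "b \<ge> 1" and \<theta>: "0 < \<theta>" "\<theta> < 1" and C: "C > 0"
    and upper: "\<And>\<delta>. \<delta> > 0 \<Longrightarrow> \<exists>K>0. \<forall>l \<nu>. K * \<theta> ^ l < \<nu> \<longrightarrow>
        (\<exists>k. Sep X D f \<delta> \<nu> \<le> enat k \<and> real k \<le> C * b ^ l)"
    and \<delta>: "\<delta> > 0" and K: "K > 0"
    and lower: "\<And>l \<nu>. \<nu> \<le> K * \<theta> ^ l \<Longrightarrow> \<exists>k. enat k \<le> Sep X D f \<delta> \<nu> \<and> b ^ l \<le> real k"
  shows "has_amorphic_complexity X D f (ereal (ln b / ln (1 / \<theta>)))"
proof -
  define L where "L = - ln \<theta>"
  define c where "c = ln b / L"
  have L: "L > 0" "ln (1 / \<theta>) = L" using \<theta> by (simp_all add: L_def ln_div)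
  have lnb: "ln b \<ge> 0" using b by simp
  have up: "Limsup (at_right 0) (\<lambda>\<nu>. ln_enat (Sep X D f \<eta> \<nu>) / ereal (- ln \<nu>)) \<le> ereal c"
    if \<eta>: "\<eta> > 0" for \<eta>
  proof -
    obtain K where K: "K > 0" "\<And>l \<nu>. K * \<theta> ^ l < \<nu> \<Longrightarrow>
        \<exists>k. Sep X D f \<eta> \<nu> \<le> enat k \<and> real k \<le> C * b ^ l"
      using upper[OF \<eta>] by blast
    define A where "A = ln C + (\<bar>ln K\<bar> / L + 1) * ln b"
    have bound: "ln_enat (Sep X D f \<eta> \<nu>) \<le> ereal (A + c * (- ln \<nu>))"
      if \<nu>: "0 < \<nu>" "\<nu> < 1" for \<nu>
    proof -
      \<comment> \<open>Solves \<open>\<theta> powr x = \<nu> / exp \<bar>ln K\<bar>\<close>. The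
        absolute value keeps \<open>x\<close> nonnegative, and an integer \<open>l > x\<close> gives
        \<open>K * \<theta> ^ l < \<nu>\<close>.\<close>
      define x where "x = (\<bar>ln K\<bar> - ln \<nu>) / L"
      define l where "l = Suc (nat \<lfloor>x\<rfloor>)"
      have "ln \<nu> \<le> 0" using \<nu> by simp
      then have x: "x \<ge> 0" using L by (simp add: x_def)
      then have l: "x < real l" "real l \<le> x + 1" unfolding l_def by linarith+
      have "\<bar>ln K\<bar> - ln \<nu> < real l * L"
        using l(1) L by (simp add: x_def field_simps)
      then have "ln (K * \<theta> ^ l) < ln \<nu>"
        using K(1) \<theta> by (simp add: ln_mult ln_realpow L_def algebra_simps)
      then have "K * \<theta> ^ l < \<nu>" using K(1) \<theta> \<nu> by simp
      then obtain k where k: "Sep X D f \<eta> \<nu> \<le> enat k" "real k \<le> C * b ^ l"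
        using K(2) by blast
      have "ln_enat (Sep X D f \<eta> \<nu>) \<le> ln_enat (enat k)" using k(1) by (rule ln_enat_mono)
      also have "\<dots> \<le> ereal (ln (C * b ^ l))"
        using k(2) by (auto simp: ln_enat_def ln_mono)
      also have "ln (C * b ^ l) = ln C + real l * ln b"
        using C b by (simp add: ln_mult ln_realpow)
      also have "ereal \<dots> \<le> ereal (ln C + (x + 1) * ln b)"
        using l(2) lnb by (simp add: mult_right_mono)
      also have "ln C + (x + 1) * ln b = A + c * (- ln \<nu>)"
        using L by (simp add: A_def c_def x_def field_simps)
      finally show ?thesis .
    qed
    have "Limsup (at_right 0) (\<lambda>\<nu>. ln_enat (Sep X D f \<eta> \<nu>) / ereal (- ln \<nu>))
      \<le> Limsup (at_right 0) (\<lambda>\<nu>. ereal ((A + c * (- ln \<nu>)) / (- ln \<nu>)))"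
    proof (intro Limsup_mono eventually_mono[OF eventually_at_right_0_less_1])
      fix \<nu> :: real assume \<nu>: "0 < \<nu> \<and> \<nu> < 1"
      then have "ln_enat (Sep X D f \<eta> \<nu>) / ereal (- ln \<nu>) \<le> ereal (A + c * (- ln \<nu>)) / ereal (- ln \<nu>)"
        using bound by (intro ereal_divide_right_mono) auto
      then show "ln_enat (Sep X D f \<eta> \<nu>) / ereal (- ln \<nu>) \<le> ereal ((A + c * (- ln \<nu>)) / (- ln \<nu>))"
        using \<nu> by simp
    qed
    also have "\<dots> = ereal c"
      by (intro lim_imp_Limsup tendsto_affine_minus_ln_quotient) simp
    finally show ?thesis .
  qed
  have lo: "ereal c \<le> Liminf (at_right 0) (\<lambda>\<nu>. ln_enat (Sep X D f \<delta> \<nu>) / ereal (- ln \<nu>))"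
  proof -
    define A where "A = (ln K / L - 1) * ln b"
    have bound: "ereal (A + c * (- ln \<nu>)) \<le> ln_enat (Sep X D f \<delta> \<nu>)"
      if \<nu>: "0 < \<nu>" "\<nu> < K" for \<nu>
    proof -
      \<comment> \<open>Here \<open>K * \<theta> powr x = \<nu>\<close>, and rounding down keeps
        \<open>\<nu> \<le> K * \<theta> ^ l\<close>; the unit lost is the \<open>- 1\<close> in
        \<open>A\<close>.\<close>
      define x where "x = (ln K - ln \<nu>) / L"
      define l where "l = nat \<lfloor>x\<rfloor>"
      have x: "x \<ge> 0" using \<nu> K L by (simp add: x_def)
      then have l: "real l \<le> x" "x - 1 \<le> real l" unfolding l_def by linarith+
      have "real l * L \<le> ln K - ln \<nu>"
        using l(1) L by (simp add: x_def field_simps)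
      then have "ln \<nu> \<le> ln (K * \<theta> ^ l)"
        using K \<theta> by (simp add: ln_mult ln_realpow L_def algebra_simps)
      then have "\<nu> \<le> K * \<theta> ^ l" using K \<theta> \<nu> by simp
      then obtain k where k: "enat k \<le> Sep X D f \<delta> \<nu>" "b ^ l \<le> real k"
        using lower by blast
      have "A + c * (- ln \<nu>) = (x - 1) * ln b"
        using L by (simp add: A_def c_def x_def field_simps)
      then have "ereal (A + c * (- ln \<nu>)) \<le> ereal (real l * ln b)"
        using l(2) lnb by (simp add: mult_right_mono)
      also have "real l * ln b = ln (b ^ l)"
        using b by (simp add: ln_realpow)
      also have "ereal \<dots> \<le> ln_enat (enat k)"
      proof -
        \<comment> \<open>Rules out \<open>k = 0\<close>, where \<open>ln_enat\<close> is
          \<open>-\<infinity>\<close>.\<close>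
        have "1 \<le> real k" using k(2) one_le_power[OF b, of l] by linarith
        then show ?thesis using k(2) b by (auto simp: ln_enat_def)
      qed
      also have "\<dots> \<le> ln_enat (Sep X D f \<delta> \<nu>)" using k(1) by (rule ln_enat_mono)
      finally show ?thesis .
    qed
    have ev: "\<forall>\<^sub>F \<nu> in at_right 0. (0 < \<nu> \<and> \<nu> < 1) \<and> \<nu> < K"
      using K by (intro eventually_conj eventually_at_right_0_less_1)
        (auto simp: eventually_at_right_field)
    have "ereal c = Liminf (at_right 0) (\<lambda>\<nu>::real. ereal ((A + c * (- ln \<nu>)) / (- ln \<nu>)))"
      by (intro lim_imp_Liminf[symmetric] tendsto_affine_minus_ln_quotient) simp
    also have "\<dots> \<le> Liminf (at_right 0) (\<lambda>\<nu>. ln_enat (Sep X D f \<delta> \<nu>) / ereal (- ln \<nu>))"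
    proof (intro Liminf_mono eventually_mono[OF ev])
      fix \<nu> :: real assume \<nu>: "(0 < \<nu> \<and> \<nu> < 1) \<and> \<nu> < K"
      then have "ereal (A + c * (- ln \<nu>)) / ereal (- ln \<nu>) \<le> ln_enat (Sep X D f \<delta> \<nu>) / ereal (- ln \<nu>)"
        using bound by (intro ereal_divide_right_mono) auto
      then show "ereal ((A + c * (- ln \<nu>)) / (- ln \<nu>)) \<le> ln_enat (Sep X D f \<delta> \<nu>) / ereal (- ln \<nu>)"
        using \<nu> by simp
    qed
    finally show ?thesis .
  qed
  have "upper_ac X D f \<le> ereal c"
    unfolding upper_ac_def using up by (intro SUP_least) simp
  moreover have "ereal c \<le> lower_ac X D f"
    unfolding lower_ac_def using lo \<delta> by (intro SUP_upper2[of \<delta>]) auto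
  ultimately show ?thesis
    using lower_ac_le_upper_ac[of X D f] L(2)
    by (auto simp: has_amorphic_complexity_def c_def)
qed


section \<open>Subshifts\<close>

lemma shift_funpow: "(shift ^^ n) x = (\<lambda>k. x (n + k))"
  by (induction n arbitrary: x) (auto simp: shift_def funpow_Suc_right simp del: funpow.simps)

lemma orbit_in_shift_orbit_closure: "(shift ^^ n) \<omega> \<in> shift_orbit_closure \<omega>"
proof -
  interpret Metric_space UNIV "cantor_dist :: (nat \<Rightarrow> 'a) \<Rightarrow> _"
    by (rule Metric_space_cantor_dist)
  show ?thesis
    unfolding shift_orbit_closure_def
    by (rule subsetD[OF closure_of_subset]) auto
qed

lemma shift_orbit_closure_approx:
  assumes "x \<in> shift_orbit_closure \<omega>"
  shows "\<exists>n. \<forall>k\<le>K. x k = \<omega> (n + k)"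
proof -
  interpret Metric_space UNIV "cantor_dist :: (nat \<Rightarrow> 'a) \<Rightarrow> _"
    by (rule Metric_space_cantor_dist)
  have "\<exists>y\<in>{(shift ^^ n) \<omega> |n. True}. y \<in> mball x ((1/2) ^ K)"
    using assms unfolding shift_orbit_closure_def metric_closure_of by simp
  then obtain n where "cantor_dist x ((shift ^^ n) \<omega>) < (1/2) ^ K"
    by auto
  then show ?thesis
    by (auto simp: cantor_dist_less_iff shift_funpow)
qed

text \<open>At scale \<open>1\<close> only the first letters count, so \<open>sep_count\<close>
  counts the places where two sequences differ.\<close>

lemma cantor_dist_ge_1_iff: "1 \<le> cantor_dist x y \<longleftrightarrow> x 0 \<noteq> y 0"
  using cantor_dist_less_iff[of x y 0] by (simp add: not_less[symmetric])

lemma separated_points_cantor_dist_commute: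
  "separated_points cantor_dist f \<delta> \<nu> x y \<longleftrightarrow> separated_points cantor_dist f \<delta> \<nu> y x"
  unfolding separated_points_def sep_count_def
  by (subst Metric_space.commute[OF Metric_space_cantor_dist]) (rule refl)

text \<open>From position \<open>k\<close> on, mismatches of \<open>\<omega>\<close> with its
  translate by \<open>l - k\<close> are mismatches of the two shifts; the first \<open>k\<close>
  positions only enlarge the constant.\<close>

lemma separated_shifts:
  assumes "\<And>N. c * real N - C \<le> real (card ({n. \<omega> n \<noteq> \<omega> (n + (l - k))} \<inter> {..<N}))"
    and "k < l" "0 \<le> c" "\<nu> \<le> c"
  shows "separated_points cantor_dist shift 1 \<nu> ((shift ^^ k) \<omega>) ((shift ^^ l) \<omega>)"
proof -
  let ?B = "{n. \<omega> n \<noteq> \<omega> (n + (l - k))}"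
  have "c * real N - (C + real k) \<le>
      real (sep_count cantor_dist shift 1 ((shift ^^ k) \<omega>) ((shift ^^ l) \<omega>) N)" for N
  proof -
    let ?S = "{n. n < N \<and> \<omega> (k + n) \<noteq> \<omega> (l + n)}"
    have "?B \<inter> {..<N} \<subseteq> {..<k} \<union> (+) k ` ?S"
    proof
      fix n assume n: "n \<in> ?B \<inter> {..<N}"
      show "n \<in> {..<k} \<union> (+) k ` ?S"
      proof (cases "n < k")
        case False
        then have "n = k + (n - k)" "l + (n - k) = n + (l - k)"
          using \<open>k < l\<close> by auto
        then show ?thesis using n by (intro UnI2 image_eqI[of _ _ "n - k"]) auto
      qed simp
    qed
    then have "card (?B \<inter> {..<N}) \<le> card ({..<k} \<union> (+) k ` ?S)"
      by (intro card_mono) auto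
    also have "\<dots> \<le> k + card ?S"
      using card_Un_le[of "{..<k}" "(+) k ` ?S"] card_image_le[of ?S "(+) k"] by simp
    finally have "real (card (?B \<inter> {..<N})) \<le> real k + real (card ?S)" by linarith
    moreover have "sep_count cantor_dist shift 1 ((shift ^^ k) \<omega>) ((shift ^^ l) \<omega>) N = card ?S"
      by (simp add: sep_count_def cantor_dist_ge_1_iff shift_funpow)
    ultimately show ?thesis using assms(1)[of N] by linarith
  qed
  then have "ereal c \<le> limsup (\<lambda>N. ereal (real (sep_count cantor_dist shift 1
      ((shift ^^ k) \<omega>) ((shift ^^ l) \<omega>) N) / real N))"
    by (rule limsup_ge_of_linear_lower_bound)
  then show ?thesis
    unfolding separated_points_def using \<open>\<nu> \<le> c\<close> by (meson ereal_less_eq(3) order_trans)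
qed

text \<open>At a time when the points are \<open>\<delta>\<close> apart, a mismatch occurs within
  the next \<open>M + 1\<close> letters. Hence such times have density at most
  \<open>Suc M * c\<close>.\<close>

lemma not_separated_of_sparse_mismatch:
  assumes mismatch: "\<And>n. x n \<noteq> y n \<Longrightarrow> n + r \<in> H"
    and sparse: "\<And>N. real (card (H \<inter> {..<N})) \<le> c * real N + C"
    and "0 \<le> c" "(1/2) ^ M \<le> \<delta>" "real (Suc M) * c < \<nu>"
  shows "\<not> separated_points cantor_dist shift \<delta> \<nu> x y"
proof -
  have "real (sep_count cantor_dist shift \<delta> x y N)
      \<le> (real (Suc M) * c) * real N + real (Suc M) * (c * real (M + r) + C)" for N
  proof -
    have "{k. k < N \<and> \<delta> \<le> cantor_dist ((shift ^^ k) x) ((shift ^^ k) y)}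
        \<subseteq> (\<Union>j\<le>M. {n. n < N \<and> n + (j + r) \<in> H})" (is "?A \<subseteq> ?U")
    proof
      fix n assume n: "n \<in> ?A"
      then have "\<not> cantor_dist ((shift ^^ n) x) ((shift ^^ n) y) < (1/2) ^ M"
        using \<open>(1/2) ^ M \<le> \<delta>\<close> by auto
      then obtain j where "j \<le> M" "x (n + j) \<noteq> y (n + j)"
        unfolding cantor_dist_less_iff shift_funpow by blast
      then show "n \<in> ?U"
        using n mismatch[of "n + j"] by (auto simp: add.assoc)
    qed
    then have "card ?A \<le> card ?U" by (intro card_mono) auto
    also have "\<dots> \<le> (\<Sum>j\<le>M. card {n. n < N \<and> n + (j + r) \<in> H})"
      by (intro card_UN_le) simp
    finally have "real (card ?A) \<le> (\<Sum>j\<le>M. real (card {n. n < N \<and> n + (j + r) \<in> H}))"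
      by (simp flip: of_nat_sum)
    also have "\<dots> \<le> (\<Sum>j\<le>M. c * real N + (c * real (M + r) + C))"
    proof (intro sum_mono)
      fix j assume j: "j \<in> {..M}"
      have "card {n. n < N \<and> n + (j + r) \<in> H} \<le> card (H \<inter> {..<N + (M + r)})"
        using j by (intro card_inj_on_le[of "\<lambda>n. n + (j + r)"]) (auto simp: inj_on_def)
      then show "real (card {n. n < N \<and> n + (j + r) \<in> H}) \<le> c * real N + (c * real (M + r) + C)"
        using sparse[of "N + (M + r)"] by (simp add: algebra_simps)
    qed
    also have "\<dots> = (real (Suc M) * c) * real N + real (Suc M) * (c * real (M + r) + C)"
      by (simp add: algebra_simps)
    finally show ?thesis by (simp add: sep_count_def)
  qed
  then have "limsup (\<lambda>N. ereal (real (sep_count cantor_dist shift \<delta> x y N) / real N))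
      \<le> ereal (real (Suc M) * c)"
    by (rule limsup_le_of_linear_upper_bound)
  then show ?thesis
    unfolding separated_points_def using assms(5) by (meson ereal_less_eq(3) not_le order_trans)
qed


section \<open>Counting holes\<close>

definition hole_count :: "'b option list \<Rightarrow> nat \<Rightarrow> nat" where
  "hole_count w n = card {k. k < n \<and> periodic_seq w k = None}"

lemma hole_count_0 [simp]: "hole_count w 0 = 0"
  by (simp add: hole_count_def)

lemma hole_count_Suc:
  "hole_count w (Suc n) = (if periodic_seq w n = None then Suc (hole_count w n) else hole_count w n)"
proof -
  have "{k. k < Suc n \<and> periodic_seq w k = None} = (if periodic_seq w n = None
      then insert n {k. k < n \<and> periodic_seq w k = None} else {k. k < n \<and> periodic_seq w k = None})"
    by (auto simp: less_Suc_eq)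
  then show ?thesis by (simp add: hole_count_def)
qed

lemma mono_hole_count: "mono (hole_count w)"
  by (rule mono_iff_le_Suc[THEN iffD2]) (simp add: hole_count_Suc)

lemma hole_count_le: "hole_count w n \<le> n"
  by (induction n) (auto simp: hole_count_Suc)

lemma hole_count_length: "hole_count w (length w) = holes w"
proof -
  have "{k. k < length w \<and> periodic_seq w k = None} = {i. i < length w \<and> w ! i = None}"
    by (auto simp: periodic_seq_def)
  then show ?thesis
    by (simp add: hole_count_def holes_def count_list_eq_length_filter length_filter_conv_card
        eq_commute[of None])
qed

lemma periodic_seq_add_mult [simp]: "periodic_seq w (n + length w * a) = periodic_seq w n"
  by (simp add: periodic_seq_def)

text \<open>Every period contributes \<open>holes w\<close> holes: translating by
  \<open>length w * a\<close> translates the filling sequence by \<open>holes w * a\<close>.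
  Periodicity and the mismatch recursion both rest on this.\<close>

lemma hole_count_add_mult: "hole_count w (n + length w * a) = hole_count w n + holes w * a"
proof -
  have step: "hole_count w (n + length w) = hole_count w n + holes w" for n
    using periodic_seq_add_mult[of w _ 1]
    by (induction n) (simp_all add: hole_count_length hole_count_Suc)
  show ?thesis
  proof (induction a)
    case (Suc a)
    then show ?case using step[of "n + length w * a"] by (simp add: algebra_simps)
  qed simp
qed

text \<open>Filling the holes of \<open>periodic_seq w\<close> with the characteristic sequence of \<open>B\<close>
  uses exactly its first \<open>hole_count w N\<close> entries below \<open>N\<close>.\<close>

lemma card_hole_preimage:
  "card ({n. periodic_seq w n = None \<and> hole_count w n \<in> B} \<inter> {..<N}) = card (B \<inter> {..<hole_count w N})"
proof (induction N)
  case (Suc N)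
  show ?case
    by (auto simp: lessThan_Suc hole_count_Suc Int_insert_right Suc)
qed simp

text \<open>Only complete periods are counted; the incomplete one costs at most
  \<open>holes w\<close>.\<close>

lemma hole_count_ge:
  assumes "w \<noteq> []"
  shows "real (holes w) / real (length w) * real N - real (holes w) \<le> real (hole_count w N)"
proof -
  let ?p = "length w" and ?q = "holes w"
  have "N < ?p * Suc (N div ?p)"
    using assms by (metis dividend_less_times_div length_greater_0_conv mult_Suc_right add.commute)
  then have "real N \<le> real ?p * (real (N div ?p) + 1)"
    by (metis (mono_tags) Suc_eq_plus1 less_imp_le of_nat_1 of_nat_add of_nat_le_iff of_nat_mult)
  then have "real ?q * real N \<le> real ?q * (real ?p * (real (N div ?p) + 1))"
    by (rule mult_left_mono) simp
  then have "real ?q / real ?p * real N \<le> real ?q * (real (N div ?p) + 1)"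
    using assms by (simp add: field_simps)
  moreover have "?q * (N div ?p) \<le> hole_count w N"
    using monoD[OF mono_hole_count, of "?p * (N div ?p)" N w] hole_count_add_mult[of w 0 "N div ?p"]
    by simp
  then have "real ?q * real (N div ?p) \<le> real (hole_count w N)"
    by (metis of_nat_le_iff of_nat_mult)
  ultimately show ?thesis by (simp add: algebra_simps)
qed

text \<open>Position \<open>0\<close> is a letter. At the end of the first period this yields
  \<open>q < p\<close>.\<close>

lemma hole_count_Suc_le:
  assumes "w \<noteq> []" "hd w \<noteq> None"
  shows "hole_count w (Suc n) \<le> n"
proof (induction n)
  case 0
  then show ?case using assms by (simp add: hole_count_Suc periodic_seq_def hd_conv_nth)
next
  case (Suc n)
  then show ?case by (subst hole_count_Suc) auto
qed


section \<open>Toeplitz words\<close>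

locale toeplitz_pattern =
  fixes w :: "'b option list"
  assumes nonempty: "w \<noteq> []" and hd_letter: "hd w \<noteq> None" and holes_pos: "holes w > 0"
begin

definition p :: nat where "p = length w"
definition q :: nat where "q = holes w"
definition d :: nat where "d = gcd p q"
definition p' :: nat where "p' = p div d"
definition q' :: nat where "q' = q div d"
definition \<theta> :: real where "\<theta> = real q / real p"
definition \<omega> :: "nat \<Rightarrow> 'b" where "\<omega> = toeplitz_word w"

text \<open>A period of \<open>toeplitz_approx w l\<close>; the factor \<open>d\<close> makes the recursion uniform from \<open>l = 0\<close>.\<close>

definition period :: "nat \<Rightarrow> nat" where "period l = d * p' ^ l"

definition hole_set :: "nat \<Rightarrow> nat set" where "hole_set l = {n. toeplitz_approx w l n = None}"

lemma p_pos: "p > 0" and q_pos: "q > 0"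
  using nonempty holes_pos by (simp_all add: p_def q_def)

lemma q_less_p: "q < p"
proof -
  obtain n where n: "length w = Suc n"
    using nonempty by (cases w) auto
  then show ?thesis
    using hole_count_Suc_le[OF nonempty hd_letter, of n] hole_count_length[of w]
    by (simp add: p_def q_def)
qed

lemma d_pos: "d > 0"
  using p_pos by (simp add: d_def)

lemma p_eq: "p = d * p'" and q_eq: "q = d * q'"
  by (simp_all add: p'_def q'_def d_def)

lemma coprime_p'_q': "coprime p' q'"
  using p_pos by (auto simp: p'_def q'_def d_def intro: div_gcd_coprime)

lemma p'_pos: "p' > 0" and q'_pos: "q' > 0"
  using p_pos q_pos p_eq q_eq by (auto intro: gr0I)

lemma \<theta>_eq: "\<theta> = real q' / real p'"
  using d_pos by (simp add: \<theta>_def p_eq[THEN arg_cong[of _ _ real]] q_eq[THEN arg_cong[of _ _ real]])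

lemma \<theta>_pos: "0 < \<theta>" and \<theta>_less_1: "\<theta> < 1"
  using p_pos q_pos q_less_p by (simp_all add: \<theta>_def)

lemma period_pos: "period l > 0"
  using d_pos p'_pos by (simp add: period_def)

lemma period_Suc: "period (Suc l) = p * p' ^ l"
  by (simp add: period_def p_eq algebra_simps)

text \<open>Translation by \<open>period (Suc l) = p * p' ^ l\<close> acts on the filling sequence
  as translation by \<open>q * p' ^ l\<close>. That this is a multiple of \<open>period l\<close>
  carries periodicity from one level to the next.\<close>

lemma q_period: "q * p' ^ l = period l * q'"
  by (simp add: period_def q_eq algebra_simps)

lemma periodic_add: "periodic_seq w (n + p * a) = periodic_seq w n"
  by (simp add: p_def)

lemma hole_count_add: "hole_count w (n + p * a) = hole_count w n + q * a"
  by (simp add: p_def q_def hole_count_add_mult)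

section \<open>Approximations and their limit\<close>

lemma approx_0: "toeplitz_approx w 0 n = None"
  by (simp add: toeplitz_approx_def)

lemma approx_Suc: "toeplitz_approx w (Suc l) n =
    (if periodic_seq w n = None then toeplitz_approx w l (hole_count w n) else periodic_seq w n)"
  by (simp add: toeplitz_approx_def fill_holes_def hole_count_def)

lemma approx_eq:
  assumes "n < l"
  shows "toeplitz_approx w l n = Some (\<omega> n)"
proof -
  interpret Metric_space UNIV "cantor_dist :: (nat \<Rightarrow> 'b option) \<Rightarrow> _"
    by (rule Metric_space_cantor_dist)
  have "\<exists>N. \<forall>l\<ge>N. cantor_dist (toeplitz_approx w l) (\<lambda>n. Some (\<omega> n)) < (1/2) ^ n"
    using limitin_toeplitz_word[OF nonempty hd_letter]
    by (auto simp: limit_metric_sequentially \<omega>_def)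
  then obtain N where N: "\<And>l. l \<ge> N \<Longrightarrow> cantor_dist (toeplitz_approx w l) (\<lambda>n. Some (\<omega> n)) < (1/2) ^ n"
    by blast
  \<comment> \<open>This level is high enough both for closeness to the limit and for position
    \<open>n\<close> to be settled.\<close>
  have "toeplitz_approx w (max N (Suc n)) n = Some (\<omega> n)"
    using N[of "max N (Suc n)"] by (simp add: cantor_dist_less_iff)
  moreover have "toeplitz_approx w (max N (Suc n)) n = toeplitz_approx w (Suc n) n"
    by (rule toeplitz_approx_stable(1)[OF nonempty hd_letter]) simp
  ultimately show ?thesis
    using toeplitz_approx_stable(1)[OF nonempty hd_letter assms] by simp
qed

lemma word_letter: "periodic_seq w n = Some a \<Longrightarrow> \<omega> n = a"
  using approx_eq[of n "Suc n"] by (simp add: approx_Suc)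

text \<open>At level \<open>Suc (Suc n)\<close> position \<open>n\<close> is settled, and so is
  \<open>hole_count w n \<le> n\<close> one level lower. Thus \<open>\<omega>\<close> arises by
  filling the holes of \<open>w\<close> with \<open>\<omega>\<close> itself.\<close>

lemma word_hole:
  assumes "periodic_seq w n = None"
  shows "\<omega> n = \<omega> (hole_count w n)"
  using approx_eq[of n "Suc (Suc n)"] approx_eq[of "hole_count w n" "Suc n"] assms
    hole_count_le[of w n] by (simp add: approx_Suc[of "Suc n"] le_imp_less_Suc)

lemma approx_letter: "toeplitz_approx w l n \<noteq> None \<Longrightarrow> toeplitz_approx w l n = Some (\<omega> n)"
proof (induction l arbitrary: n)
  case (Suc l)
  show ?case
  proof (cases "periodic_seq w n = None")
    case True
    then show ?thesis using Suc by (simp add: approx_Suc word_hole[OF True])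
  next
    case False
    then show ?thesis by (auto simp: approx_Suc word_letter)
  qed
qed (simp add: approx_0)

lemma approx_periodic: "toeplitz_approx w l (n + period l * a) = toeplitz_approx w l n"
proof (induction l arbitrary: n a)
  case (Suc l)
  have "n + period (Suc l) * a = n + p * (p' ^ l * a)"
    by (simp add: period_Suc mult.assoc)
  moreover have "hole_count w (n + p * (p' ^ l * a)) = hole_count w n + period l * (q' * a)"
    using hole_count_add[of n "p' ^ l * a"] q_period[of l] by (metis mult.assoc)
  ultimately show ?case
    by (simp only: approx_Suc periodic_add Suc)
qed (simp add: approx_0)

section \<open>Holes of the approximations\<close>

lemma hole_set_0: "hole_set 0 = UNIV"
  by (simp add: hole_set_def approx_0)

lemma hole_set_Suc: "hole_set (Suc l) = {n. periodic_seq w n = None \<and> hole_count w n \<in> hole_set l}"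
  by (auto simp: hole_set_def approx_Suc)

text \<open>One level multiplies the period by \<open>p'\<close> and the number of holes in it by
  \<open>q'\<close>, since holes at level \<open>Suc l\<close> are the holes of \<open>w\<close>
  filled from holes at level \<open>l\<close>.\<close>

lemma card_hole_set: "card (hole_set l \<inter> {..<period l * a}) = d * q' ^ l * a"
proof (induction l arbitrary: a)
  case 0
  then show ?case by (simp add: hole_set_0 period_def)
next
  case (Suc l)
  have "hole_count w (period (Suc l) * a) = period l * (q' * a)"
    using hole_count_add[of 0 "p' ^ l * a"] by (simp add: period_Suc q_period flip: mult.assoc)
  then show ?case
    by (simp add: hole_set_Suc card_hole_preimage Suc)
qed

lemma card_hole_set_density: "real (d * q' ^ l) = \<theta> ^ l * real (period l)"
  using p'_pos by (simp add: \<theta>_eq period_def power_divide)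

lemma card_hole_set_le: "real (card (hole_set l \<inter> {..<N})) \<le> \<theta> ^ l * real N + real (d * q' ^ l)"
proof -
  let ?P = "period l" and ?k = "N div period l"
  have "N < ?P * Suc ?k"
    using dividend_less_times_div[OF period_pos] by simp
  then have "card (hole_set l \<inter> {..<N}) \<le> card (hole_set l \<inter> {..<?P * Suc ?k})"
    by (intro card_mono) auto
  then have "real (card (hole_set l \<inter> {..<N})) \<le> real (d * q' ^ l * Suc ?k)"
    by (simp only: card_hole_set of_nat_le_iff)
  also have "\<dots> = real (d * q' ^ l) * real ?k + real (d * q' ^ l)"
    by (simp add: algebra_simps)
  also have "real (d * q' ^ l) * real ?k = \<theta> ^ l * real (?P * ?k)"
    unfolding card_hole_set_density by simp
  also have "\<theta> ^ l * real (?P * ?k) \<le> \<theta> ^ l * real N"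
    using \<theta>_pos by (intro mult_left_mono) (simp_all del: of_nat_mult)
  finally show ?thesis by simp
qed

section \<open>Regularity\<close>

lemma non_hole_in_Per: "n \<notin> hole_set l \<Longrightarrow> n \<in> Per (period l) \<omega>"
  using approx_letter[of l n] approx_letter[of l "n + period l * _"] approx_periodic[of l n]
  by (auto simp: Per_def hole_set_def)

lemma not_in_hole_set: "n \<notin> hole_set (Suc n)"
  by (simp add: hole_set_def approx_eq)

text \<open>A position that is no longer a hole is periodic, position \<open>n\<close> is settled at
  level \<open>Suc n\<close>, and the remaining holes have density \<open>\<theta> ^ l\<close>,
  which tends to \<open>0\<close>.\<close>

lemma regular_toeplitz_word: "regular_toeplitz \<omega>"
proof -
  have Per: "n \<in> Per (period (Suc n)) \<omega>" for n
    by (rule non_hole_in_Per[OF not_in_hole_set])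
  have "toeplitz \<omega>"
    unfolding toeplitz_def
  proof
    fix k
    show "\<exists>p>0. \<forall>l. \<omega> (k + p * l) = \<omega> k"
      using Per[of k] period_pos[of "Suc k"] unfolding Per_def by blast
  qed
  moreover have "(\<Union>l. Per (period l) \<omega>) = UNIV"
    using Per by blast
  moreover have "period l dvd period (Suc l)" for l
    by (simp add: period_def)
  moreover have "(\<lambda>l. per_density \<omega> (period l)) \<longlonglongrightarrow> 1"
  proof (rule tendsto_sandwich)
    have "(\<lambda>l. 1 - \<theta> ^ l) \<longlonglongrightarrow> 1 - 0"
      using \<theta>_pos \<theta>_less_1 by (intro tendsto_diff tendsto_const LIMSEQ_power_zero) auto
    then show "(\<lambda>l. 1 - \<theta> ^ l) \<longlonglongrightarrow> 1" by simp
    have "1 - \<theta> ^ l \<le> per_density \<omega> (period l)" for l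
    proof -
      let ?P = "period l" and ?R = "Per (period l) \<omega> \<inter> {0..<period l}"
      have "{..<?P} \<subseteq> ?R \<union> (hole_set l \<inter> {..<?P})"
        using non_hole_in_Per[of _ l] by auto
      then have "card {..<?P} \<le> card (?R \<union> (hole_set l \<inter> {..<?P}))"
        by (intro card_mono) auto
      also have "\<dots> \<le> card ?R + card (hole_set l \<inter> {..<?P})"
        by (rule card_Un_le)
      also have "card (hole_set l \<inter> {..<?P}) = d * q' ^ l"
        using card_hole_set[of l 1] by simp
      finally have "real ?P \<le> real (card ?R) + \<theta> ^ l * real ?P"
        unfolding card_hole_set_density[symmetric] by (simp flip: of_nat_add del: of_nat_mult)
      then show ?thesis
        using period_pos[of l] by (simp add: per_density_def field_simps)
    qed
    then show "\<forall>\<^sub>F l in sequentially. 1 - \<theta> ^ l \<le> per_density \<omega> (period l)" by simp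
    have "per_density \<omega> (period l) \<le> 1" for l
      using card_mono[of "{0..<period l}" "Per (period l) \<omega> \<inter> {0..<period l}"] period_pos[of l]
      by (simp add: per_density_def)
    then show "\<forall>\<^sub>F l in sequentially. per_density \<omega> (period l) \<le> 1" by simp
  qed simp
  ultimately show ?thesis
    unfolding regular_toeplitz_def using period_pos by blast
qed

section \<open>Upper bound for separated sets\<close>

lemma closure_residue:
  assumes "x \<in> shift_orbit_closure \<omega>"
  shows "\<exists>r<period l. \<forall>k. k + r \<notin> hole_set l \<longrightarrow> x k = \<omega> (k + r)"
proof (rule ccontr)
  \<comment> \<open>One residue must serve all positions \<open>k\<close>. If each of the finitely
    many residues failed somewhere, a window containing all these failures would match a translate
    of \<open>\<omega>\<close>, whose own residue cannot fail there.\<close>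
  assume "\<not> ?thesis"
  then obtain f where f: "\<And>r. r < period l \<Longrightarrow> f r + r \<notin> hole_set l \<and> x (f r) \<noteq> \<omega> (f r + r)"
    by metis
  obtain n where n: "\<And>k. k \<le> Max (f ` {..<period l}) \<Longrightarrow> x k = \<omega> (n + k)"
    using shift_orbit_closure_approx[OF assms] by blast
  define r where "r = n mod period l"
  have r: "r < period l" "n = r + period l * (n div period l)"
    using period_pos by (simp_all add: r_def)
  then have "x (f r) = \<omega> (n + f r)" by (intro n Max_ge) auto
  also have "n + f r = (f r + r) + period l * (n div period l)"
    using r(2) by linarith
  also have "\<omega> \<dots> = \<omega> (f r + r)"
    using non_hole_in_Per f[OF r(1)] unfolding Per_def by blast
  finally show False using f[OF r(1)] by simp
qed

text \<open>Points with a common residue differ only at holes, which are too sparse to separate them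
  at \<open>\<nu>\<close>. So a separated set injects into the residues.\<close>

lemma Sep_le:
  assumes "(1/2) ^ M \<le> \<delta>" "real (Suc M) * \<theta> ^ l < \<nu>"
  shows "Sep (shift_orbit_closure \<omega>) cantor_dist shift \<delta> \<nu> \<le> enat (period l)"
  unfolding Sep_def
proof (rule SUP_least)
  fix S :: "(nat \<Rightarrow> 'b) set"
  assume S: "S \<in> {S. S \<subseteq> shift_orbit_closure \<omega> \<and> separated_set cantor_dist shift \<delta> \<nu> S}"
  then have "\<forall>x\<in>S. \<exists>r<period l. \<forall>k. k + r \<notin> hole_set l \<longrightarrow> x k = \<omega> (k + r)"
    using closure_residue by blast
  then obtain r where r: "\<And>x. x \<in> S \<Longrightarrow> r x < period l"
      "\<And>x k. x \<in> S \<Longrightarrow> k + r x \<notin> hole_set l \<Longrightarrow> x k = \<omega> (k + r x)"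
    by metis
  have inj: "inj_on r S"
  proof (rule inj_onI, rule ccontr)
    fix x y assume xy: "x \<in> S" "y \<in> S" "r x = r y" "x \<noteq> y"
    have mismatch: "n + r x \<in> hole_set l" if "x n \<noteq> y n" for n
      using that r(2)[of x n] r(2)[of y n] xy by auto
    have "\<not> separated_points cantor_dist shift \<delta> \<nu> x y"
      using \<theta>_pos
      by (intro not_separated_of_sparse_mismatch[OF mismatch card_hole_set_le _ assms]) auto
    then show False using S xy by (simp add: separated_set_def)
  qed
  have sub: "r ` S \<subseteq> {..<period l}" using r(1) by auto
  have "finite S" using inj_on_finite[OF inj sub] by simp
  moreover have "card S \<le> period l" using card_inj_on_le[OF inj sub] by simp
  ultimately show "(if finite S then enat (card S) else \<infinity>) \<le> enat (period l)"
    by simp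
qed

end

section \<open>Lower bound for separated sets\<close>

locale distinguishing_pattern = toeplitz_pattern +
  assumes distinguishing: "\<And>j. \<not> length w dvd j \<Longrightarrow>
    \<exists>n a b. periodic_seq w n = Some a \<and> periodic_seq w (n + j) = Some b \<and> a \<noteq> b"
begin

text \<open>Two distinct letters of \<open>w\<close> disagree whatever fills the holes, and the
  disagreement recurs in every period. The \<open>- 1\<close> pays for the incomplete last
  period.\<close>

lemma mismatch_of_not_dvd:
  assumes "\<not> p dvd j"
  shows "real N / real p - 1 \<le> real (card ({n. \<omega> n \<noteq> \<omega> (n + j)} \<inter> {..<N}))"
proof -
  obtain n a b where n: "periodic_seq w n = Some a" "periodic_seq w (n + j) = Some b" "a \<noteq> b"
    using distinguishing assms unfolding p_def by blast
  define r where "r = n mod p"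
  have r: "r < p" "periodic_seq w r = Some a" "periodic_seq w (r + j) = Some b"
    using n p_pos by (simp_all add: r_def periodic_seq_def p_def mod_add_left_eq)
  have "(\<lambda>i. r + p * i) ` {..<N div p} \<subseteq> {n. \<omega> n \<noteq> \<omega> (n + j)} \<inter> {..<N}"
  proof
    fix x assume "x \<in> (\<lambda>i. r + p * i) ` {..<N div p}"
    then obtain i where i: "i < N div p" "x = r + p * i" by blast
    have "x < p * Suc i" using i r(1) by simp
    also have "\<dots> \<le> p * (N div p)" using i by (intro mult_le_mono2) simp
    also have "\<dots> \<le> N" by simp
    finally have "x < N" .
    moreover have "\<omega> x = a" "\<omega> (x + j) = b"
      using r periodic_add[of r i] periodic_add[of "r + j" i]
      by (auto intro!: word_letter simp: i(2) add_ac)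
    ultimately show "x \<in> {n. \<omega> n \<noteq> \<omega> (n + j)} \<inter> {..<N}" using n(3) by simp
  qed
  then have "card ((\<lambda>i. r + p * i) ` {..<N div p}) \<le> card ({n. \<omega> n \<noteq> \<omega> (n + j)} \<inter> {..<N})"
    by (intro card_mono) auto
  moreover have "card ((\<lambda>i. r + p * i) ` {..<N div p}) = N div p"
    using p_pos by (subst card_image) (auto simp: inj_on_def)
  moreover have "real N / real p - 1 \<le> real (N div p)"
  proof -
    have "real N \<le> real (p * Suc (N div p))"
      using dividend_less_times_div[OF p_pos, of N] by (simp only: of_nat_le_iff mult_Suc_right)
    then show ?thesis using p_pos by (simp add: field_simps)
  qed
  ultimately show ?thesis by linarith
qed

text \<open>The translation by \<open>p * i\<close> fixes all letters of \<open>periodic_seq w\<close> and acts on the sequence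
  filling the holes, which is \<open>\<omega>\<close> itself, as the translation by \<open>q * i\<close>.\<close>

lemma mismatch_multiple:
  "{n. \<omega> n \<noteq> \<omega> (n + p * i)} = {n. periodic_seq w n = None \<and> hole_count w n \<in> {n. \<omega> n \<noteq> \<omega> (n + q * i)}}"
proof (intro Collect_cong)
  fix n
  show "\<omega> n \<noteq> \<omega> (n + p * i) \<longleftrightarrow> periodic_seq w n = None \<and> hole_count w n \<in> {n. \<omega> n \<noteq> \<omega> (n + q * i)}"
  proof (cases "periodic_seq w n")
    case None
    then show ?thesis
      using word_hole[of n] word_hole[of "n + p * i"] by (simp add: periodic_add hole_count_add)
  next
    case (Some a)
    then show ?thesis
      using word_letter[of n a] word_letter[of "n + p * i" a] by (simp add: periodic_add)
  qed
qed

text \<open>When \<open>j = p * i\<close>, \<open>mismatch_multiple\<close> passes to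
  \<open>q * i\<close> at the cost of a factor \<open>\<theta>\<close> and of one level of
  non-divisibility; otherwise \<open>mismatch_of_not_dvd\<close> applies.\<close>

lemma mismatch_linear:
  assumes "\<not> period (Suc l) dvd j"
  shows "\<exists>C. \<forall>N. 1 / real p * \<theta> ^ l * real N - C \<le> real (card ({n. \<omega> n \<noteq> \<omega> (n + j)} \<inter> {..<N}))"
  using assms
proof (induction l arbitrary: j)
  case 0
  then have "\<not> p dvd j" by (simp add: period_Suc)
  then show ?case
    using mismatch_of_not_dvd[of j] by (intro exI[of _ 1]) simp
next
  case (Suc l)
  show ?case
  proof (cases "p dvd j")
    case False
    \<comment> \<open>The recursion stops early, and the density \<open>1 / p\<close> is at least
      what is claimed.\<close>
    have "\<theta> ^ Suc l \<le> 1" using \<theta>_pos \<theta>_less_1 by (intro power_le_one) auto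
    then have "1 / real p * \<theta> ^ Suc l * real N \<le> 1 / real p * 1 * real N" for N
      by (intro mult_right_mono mult_left_mono) auto
    then have "1 / real p * \<theta> ^ Suc l * real N \<le> real N / real p" for N
      by simp
    then have "1 / real p * \<theta> ^ Suc l * real N - 1
        \<le> real (card ({n. \<omega> n \<noteq> \<omega> (n + j)} \<inter> {..<N}))" for N
      using mismatch_of_not_dvd[OF False, of N] by (meson diff_right_mono order_trans)
    then show ?thesis by blast
  next
    case True
    then obtain i where j: "j = p * i" by blast
    \<comment> \<open>If \<open>p' ^ Suc l\<close> divides \<open>q' * i\<close>, it divides
      \<open>i\<close>, as \<open>p'\<close> and \<open>q'\<close> are coprime.\<close>
    have "\<not> period (Suc l) dvd q * i"
    proof
      assume "period (Suc l) dvd q * i"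
      then have "p' ^ Suc l dvd q' * i"
        using d_pos by (simp add: period_def q_eq mult.assoc)
      then have "p' ^ Suc l dvd i"
        using coprime_p'_q' by (simp add: coprime_dvd_mult_right_iff coprime_power_left_iff)
      then have "period (Suc (Suc l)) dvd j"
        by (simp only: period_Suc j) (rule mult_dvd_mono[OF dvd_refl])
      then show False using Suc.prems by simp
    qed
    then obtain C where C: "\<And>N. 1 / real p * \<theta> ^ l * real N - C
        \<le> real (card ({n. \<omega> n \<noteq> \<omega> (n + q * i)} \<inter> {..<N}))"
      using Suc.IH by blast
    let ?c = "1 / real p * \<theta> ^ l"
    have "?c \<ge> 0" using \<theta>_pos by simp
    \<comment> \<open>The extra \<open>?c * real q\<close> is the error of
      \<open>hole_count_ge\<close>.\<close>
    have "1 / real p * \<theta> ^ Suc l * real N - (?c * real q + C)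
        \<le> real (card ({n. \<omega> n \<noteq> \<omega> (n + j)} \<inter> {..<N}))" for N
    proof -
      have "1 / real p * \<theta> ^ Suc l * real N - (?c * real q + C) = ?c * (\<theta> * real N - real q) - C"
        by (simp add: algebra_simps)
      also have "\<dots> \<le> ?c * real (hole_count w N) - C"
        using hole_count_ge[OF nonempty, of N] \<open>?c \<ge> 0\<close>
        by (intro diff_right_mono mult_left_mono) (simp_all add: \<theta>_def p_def q_def)
      also have "\<dots> \<le> real (card ({n. \<omega> n \<noteq> \<omega> (n + q * i)} \<inter> {..<hole_count w N}))"
        by (rule C)
      also have "\<dots> = real (card ({n. \<omega> n \<noteq> \<omega> (n + j)} \<inter> {..<N}))"
        unfolding j mismatch_multiple card_hole_preimage ..
      finally show ?thesis .
    qed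
    then show ?thesis by blast
  qed
qed

text \<open>Distinct indices below \<open>period (Suc l)\<close> differ by a non-multiple of it, so
  \<open>mismatch_linear\<close> separates the corresponding orbit points.\<close>

lemma le_Sep:
  assumes "\<nu> \<le> 1 / real p * \<theta> ^ l"
  shows "enat (period (Suc l)) \<le> Sep (shift_orbit_closure \<omega>) cantor_dist shift 1 \<nu>"
proof -
  define c where "c = 1 / real p * \<theta> ^ l"
  have c: "c > 0" using \<theta>_pos p_pos by (simp add: c_def)
  let ?x = "\<lambda>i. (shift ^^ i) \<omega>"
  have less: "separated_points cantor_dist shift 1 \<mu> (?x i) (?x j)"
    if "i < j" "j < period (Suc l)" "\<mu> \<le> c" for i j \<mu>
  proof -
    have "\<not> period (Suc l) dvd j - i"
      using that by (auto dest: dvd_imp_le)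
    then obtain C where "\<And>N. c * real N - C \<le> real (card ({n. \<omega> n \<noteq> \<omega> (n + (j - i))} \<inter> {..<N}))"
      using mismatch_linear unfolding c_def by blast
    then show ?thesis
      using that c by (intro separated_shifts) auto
  qed
  have sep: "separated_points cantor_dist shift 1 \<mu> (?x i) (?x j)"
    if "i \<noteq> j" "i < period (Suc l)" "j < period (Suc l)" "\<mu> \<le> c" for i j \<mu>
    using less[of i j \<mu>] less[of j i \<mu>] that
    by (cases "i < j") (auto simp: separated_points_cantor_dist_commute[of _ _ _ "?x i"])
  \<comment> \<open>As \<open>\<nu>\<close> may be nonpositive, the points are shown distinct at the
    positive threshold \<open>c\<close>, at which no point is separated from itself.\<close>
  have "\<not> separated_points cantor_dist shift 1 c x x" for x :: "nat \<Rightarrow> 'a"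
    using c by (intro not_separated_of_sparse_mismatch[where H = "{}" and c = 0 and C = 0 and M = 0]) auto
  then have inj: "inj_on ?x {..<period (Suc l)}"
    using sep[of _ _ c] by (intro inj_onI) (metis lessThan_iff order_refl)
  let ?S = "?x ` {..<period (Suc l)}"
  have "?S \<in> {S. S \<subseteq> shift_orbit_closure \<omega> \<and> separated_set cantor_dist shift 1 \<nu> S}"
  proof -
    have "?S \<subseteq> shift_orbit_closure \<omega>"
      by (auto intro: orbit_in_shift_orbit_closure)
    moreover have "separated_set cantor_dist shift 1 \<nu> ?S"
      unfolding separated_set_def
    proof clarify
      fix i j assume "i < period (Suc l)" "j < period (Suc l)" "?x i \<noteq> ?x j"
      then show "separated_points cantor_dist shift 1 \<nu> (?x i) (?x j)"
        using assms by (intro sep) (auto simp: c_def)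
    qed
    ultimately show ?thesis by blast
  qed
  moreover have "enat (period (Suc l)) \<le> (if finite ?S then enat (card ?S) else \<infinity>)"
    by (simp add: card_image[OF inj])
  ultimately show ?thesis
    unfolding Sep_def by (rule SUP_upper2)
qed

lemma amorphic_complexity:
  "has_amorphic_complexity (shift_orbit_closure \<omega>) cantor_dist shift
     (ereal (ln (real p') / ln (1 / \<theta>)))"
proof (rule has_amorphic_complexity_geometric)
  show "1 \<le> real p'" "0 < real d" "0 < \<theta>" "\<theta> < 1" "(0::real) < 1" "0 < 1 / real p"
    using p'_pos d_pos p_pos \<theta>_pos \<theta>_less_1 by simp_all
next
  fix \<delta> :: real assume "\<delta> > 0"
  then obtain M where M: "(1/2) ^ M < \<delta>"
    using real_arch_pow_inv[of \<delta> "1/2"] by auto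
  have "\<exists>k. Sep (shift_orbit_closure \<omega>) cantor_dist shift \<delta> \<nu> \<le> enat k \<and> real k \<le> real d * real p' ^ l"
    if "real (Suc M) * \<theta> ^ l < \<nu>" for l \<nu>
    using Sep_le[OF less_imp_le[OF M] that] by (intro exI[of _ "period l"]) (simp add: period_def)
  then show "\<exists>K>0. \<forall>l \<nu>. K * \<theta> ^ l < \<nu> \<longrightarrow>
      (\<exists>k. Sep (shift_orbit_closure \<omega>) cantor_dist shift \<delta> \<nu> \<le> enat k \<and> real k \<le> real d * real p' ^ l)"
    by (intro exI[of _ "real (Suc M)"]) auto
next
  fix l :: nat and \<nu> :: real assume "\<nu> \<le> 1 / real p * \<theta> ^ l"
  then have "enat (period (Suc l)) \<le> Sep (shift_orbit_closure \<omega>) cantor_dist shift 1 \<nu>"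
    by (rule le_Sep)
  \<comment> \<open>The factor \<open>p\<close> of \<open>period (Suc l)\<close> is dropped, which
    leaves the growth rate unchanged.\<close>
  moreover have "real p' ^ l \<le> real (period (Suc l))"
    using p_pos mult_right_mono[of 1 "real p" "real p' ^ l"] by (simp add: period_Suc)
  ultimately show "\<exists>k. enat k \<le> Sep (shift_orbit_closure \<omega>) cantor_dist shift 1 \<nu> \<and> real p' ^ l \<le> real k"
    by blast
qed

end

text \<open>Either the shift by \<open>j\<close> or the shift by \<open>p - j\<close> moves the letter 1 at position \<open>m\<close> into
  the block of zeros, because the rest of the word is at most as long as that block.\<close>

lemma distinguishing_zeros_one:
  fixes v :: "bit option list"
  assumes "length v \<le> m" and w: "w = replicate m (Some 0) @ [Some 1] @ v" and j: "\<not> length w dvd j"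
  shows "\<exists>n a b. periodic_seq w n = Some a \<and> periodic_seq w (n + j) = Some b \<and> a \<noteq> b"
proof -
  let ?p = "length w"
  have p: "?p = m + 1 + length v" using w by simp
  have zero: "periodic_seq w n = Some 0" if "n < m" for n
    using that p by (simp add: periodic_seq_def) (simp add: w nth_append)
  have one: "periodic_seq w m = Some 1"
    using p by (simp add: periodic_seq_def) (simp add: w nth_append)
  define i where "i = j mod ?p"
  have i: "0 < i" "i < ?p"
    using j p by (auto simp: i_def dvd_eq_mod_eq_0)
  have shift: "periodic_seq w (n + j) = periodic_seq w (n + i)" for n
    by (simp add: periodic_seq_def i_def mod_add_right_eq)
  show ?thesis
  proof (cases "i \<le> m")
    case True
    then have "periodic_seq w (m - i) = Some 0" "periodic_seq w (m - i + j) = Some 1"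
      using i zero[of "m - i"] one shift[of "m - i"] by (simp_all del: diff_add_assoc2)
    then show ?thesis by (intro exI conjI) auto
  next
    case False
    \<comment> \<open>From \<open>i > m \<ge> length v\<close> follows
      \<open>m + i \<ge> ?p\<close>, so the subtraction is not truncated: the position has wrapped
      round into the zeros.\<close>
    then have "m + i = (m + i - ?p) + ?p * 1" "m + i - ?p < m"
      using i p assms(1) by linarith+
    then have "periodic_seq w (m + i) = Some 0"
      using periodic_seq_add_mult[of w "m + i - ?p" 1] zero by metis
    then show ?thesis
      using one shift[of m] by auto
  qed
qed

theorem theorem5p6:
  fixes m p q d :: nat and v w :: "bit option list" and \<omega> :: "nat \<Rightarrow> bit"
  assumes "m \<ge> 1"
    and "1 \<le> holes v" and "holes v \<le> length v" and "length v \<le> m"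
    and "w = replicate m (Some 0) @ [Some 1] @ v"
    and "p = length w" and "q = holes w" and "d = gcd p q"
    and "\<omega> = toeplitz_word w"
  shows "pq_toeplitz_word p q \<omega> \<and> regular_toeplitz \<omega> \<and>
    has_amorphic_complexity (shift_orbit_closure \<omega>) cantor_dist shift
      (ereal (ln (real p / real d) / ln (real p / real q)))"
proof -
  have w: "w \<noteq> []" "hd w \<noteq> None" "holes w > 0"
    using assms(1,2,5) by (auto simp: hd_append holes_def)
  interpret T: distinguishing_pattern w
    using w distinguishing_zeros_one[OF assms(4,5)] by unfold_locales
  have eq: "T.p = p" "T.q = q" "T.d = d" "T.\<omega> = \<omega>"
    using assms(6-9) by (simp_all add: T.p_def T.q_def T.d_def T.\<omega>_def)
  \<comment> \<open>The integer quotient is exact, as \<open>d\<close> divides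
    \<open>p\<close>.\<close>
  have "real T.p' = real p / real d"
    by (simp add: T.p'_def eq assms(8) real_of_nat_div)
  moreover have "1 / T.\<theta> = real p / real q"
    by (simp add: T.\<theta>_def eq)
  moreover have "pq_toeplitz_word p q \<omega>"
    unfolding pq_toeplitz_word_def using w assms(6-9) by blast
  ultimately show ?thesis
    using T.regular_toeplitz_word T.amorphic_complexity by (simp add: eq)
qed

end
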